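(* Let $K\subseteq\mathbb{R}^k$ be a nontrivial pointed closed convex cone, let $L\in\mathbb{R}^{k\times n}$, $A\in\mathbb{R}^{m\times n}$, $b\in\mathbb{R}^m$, and let $\mathcal{A}=\{x\in\mathbb{R}^n_+ : Ax=b\}$. Consider the linear vector optimization problem $(P)$ of minimizing $Lx$ over $x\in\mathcal{A}$ with respect to the partial ordering induced by $K$. Then every efficient solution to $(P)$ is properly efficient (in the sense of linear scalarization) to $(P)$. That is, if $\bar x\in\mathcal{A}$ and there is no $x\in\mathcal{A}$ with $Lx\leq_K L\bar x$, then there exists $\lambda\in K^{*0}$ such that $\lambda^T(L\bar x)\leq\lambda^T(Lx)$ for all $x\in\mathcal{A}$.
   Context: $\mathbb{R}^n_+$ denotes the nonnegative orthant. A set $K\subseteq\mathbb{R}^k$ is a cone if $\lambda K\subseteq K$ for all $\lambda\geq 0$; it is nontrivial if $K\neq\{0\}$ and $K\neq\mathbb{R}^k$, and pointed if $K\cap(-K)=\{0\}$. Write $v\leqq_K w$ if $w-v\in K$, and $v\leq_K w$ if $v\leqq_K w$ and $v\neq w$. Set $K^{*0}=\{\lambda\in\mathbb{R}^k:\lambda^Tv>0\ \forall v\in K\setminus\{0\}\}$. An element $\bar x\in\mathcal{A}$ is an efficient solution to $(P)$ if there is no $x\in\mathcal{A}$ with $Lx\leq_K L\bar x$. It is a properly efficient solution (in the sense of linear scalarization) to $(P)$ if there is $\lambda\in K^{*0}$ with $\lambda^T(L\bar x)\leq\lambda^T(Lx)$ for all $x\in\mathcal{A}$. *)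

theory Defs
  imports "HOL-Analysis.Analysis"
begin

definition nontrivial_cone :: "(real ^ 'k) set \<Rightarrow> bool" where
  "nontrivial_cone K \<longleftrightarrow> cone K \<and> K \<noteq> {0} \<and> K \<noteq> UNIV"

(* The library's cone predicate also holds of the empty set; pointedness excludes it,
   since it forces 0 to lie in K. *)
definition pointed_cone :: "(real ^ 'k) set \<Rightarrow> bool" where
  "pointed_cone K \<longleftrightarrow> cone K \<and> K \<inter> uminus ` K = {0}"

definition cone_leqq :: "(real ^ 'k) set \<Rightarrow> real ^ 'k \<Rightarrow> real ^ 'k \<Rightarrow> bool" where
  "cone_leqq K v w \<longleftrightarrow> w - v \<in> K"

definition cone_leq :: "(real ^ 'k) set \<Rightarrow> real ^ 'k \<Rightarrow> real ^ 'k \<Rightarrow> bool" where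
  "cone_leq K v w \<longleftrightarrow> cone_leqq K v w \<and> v \<noteq> w"

(* The set written K^{*0}. *)
definition quasi_interior_dual :: "(real ^ 'k) set \<Rightarrow> (real ^ 'k) set" where
  "quasi_interior_dual K = {l. \<forall>v\<in>K - {0}. l \<bullet> v > 0}"

definition nonneg_orthant :: "(real ^ 'n) set" where
  "nonneg_orthant = {x. \<forall>i. 0 \<le> x $ i}"

definition feasible_set :: "real ^ 'n ^ 'm \<Rightarrow> real ^ 'm \<Rightarrow> (real ^ 'n) set" where
  "feasible_set A b = {x \<in> nonneg_orthant. A *v x = b}"

definition efficient_solution ::
  "(real ^ 'k) set \<Rightarrow> real ^ 'n ^ 'k \<Rightarrow> real ^ 'n ^ 'm \<Rightarrow> real ^ 'm \<Rightarrow> real ^ 'n \<Rightarrow> bool" where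
  "efficient_solution K L A b xbar \<longleftrightarrow>
     xbar \<in> feasible_set A b \<and>
     \<not> (\<exists>x\<in>feasible_set A b. cone_leq K (L *v x) (L *v xbar))"

definition properly_efficient_solution ::
  "(real ^ 'k) set \<Rightarrow> real ^ 'n ^ 'k \<Rightarrow> real ^ 'n ^ 'm \<Rightarrow> real ^ 'm \<Rightarrow> real ^ 'n \<Rightarrow> bool" where
  "properly_efficient_solution K L A b xbar \<longleftrightarrow>
     xbar \<in> feasible_set A b \<and>
     (\<exists>l\<in>quasi_interior_dual K. \<forall>x\<in>feasible_set A b. l \<bullet> (L *v xbar) \<le> l \<bullet> (L *v x))"

end

theory Submission
  imports Defs
begin

text \<open>
  Let \<open>T\<close> be the cone of feasible directions at the efficient point \<open>xbar\<close>. Since the constraints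
  are linear, \<open>T\<close> is polyhedral and each of its elements is, up to a positive factor, a difference
  \<open>x - xbar\<close> with \<open>x\<close> feasible; so efficiency says that \<open>L T\<close> meets \<open>- K\<close> only in \<open>0\<close>. A linear
  image of a polyhedral cone is closed, and \<open>- K\<close> has a compact convex base (the convex hull of its
  unit vectors) that avoids \<open>0\<close>. Strictly separating this base from \<open>L T\<close> gives a functional that
  is nonnegative on the cone \<open>L T\<close> and positive on \<open>K - {0}\<close>.
\<close>

lemma closed_linear_image_polyhedral_cone:
  fixes f :: "'a::euclidean_space \<Rightarrow> 'b::euclidean_space"
  assumes "linear f" "polyhedron T" "cone T"
  shows "closed (f ` T)"
proof -
  define Q where "Q = T \<inter> cbox (- One) One"
  have "polytope Q"
    using assms(2) by (simp add: Q_def polytope_eq_bounded_polyhedron bounded_Int)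
  then have "closed (conic hull (f ` Q))"
    using assms(1) by (simp add: polytope_linear_image closed_conic_hull_strong)
  moreover have "conic hull Q = T"
  proof (intro equalityI subsetI)
    fix x assume "x \<in> conic hull Q"
    then show "x \<in> T"
      using assms(3) by (auto simp: conic_hull_explicit Q_def cone_def)
  next
    fix x assume x: "x \<in> T"
    \<comment> \<open>Coordinates are bounded by the norm. For \<open>x = 0\<close> the factor
      \<open>1 / 0\<close> is 0, which still gives a point of \<open>Q\<close>.\<close>
    have "(1 / norm x) *\<^sub>R x \<in> Q"
      using x assms(3) Basis_le_norm[of _ x]
      by (auto simp: Q_def cone_def mem_box abs_le_iff divide_simps dest: minus_le_iff[THEN iffD1])
    then have "norm x *\<^sub>R ((1 / norm x) *\<^sub>R x) \<in> conic hull Q"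
      by (rule conic_mul[OF conic_conic_hull hull_inc norm_ge_zero])
    then show "x \<in> conic hull Q"
      using \<open>(1 / norm x) *\<^sub>R x \<in> Q\<close> by (cases "x = 0") (auto simp: hull_inc)
  qed
  ultimately show ?thesis
    using assms(1) by (simp add: conic_hull_linear_image)
qed

text \<open>A vanishing convex combination would put its first term in both \<open>K\<close> and
  \<open>- K\<close>, so both terms would be 0. This keeps the convex hull of the unit vectors of
  \<open>K\<close> away from 0.\<close>

lemma convex_pointed_cone_minus_zero:
  fixes K :: "'a::real_vector set"
  assumes "convex K" "cone K" "K \<inter> uminus ` K = {0}"
  shows "convex (K - {0})"
proof (rule convexI)
  fix x y and u v :: real
  assume xy: "x \<in> K - {0}" "y \<in> K - {0}" and uv: "0 \<le> u" "0 \<le> v" "u + v = 1"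
  have "u *\<^sub>R x + v *\<^sub>R y \<in> K"
    using assms(1) xy uv by (auto intro: convexD)
  moreover have "u *\<^sub>R x + v *\<^sub>R y \<noteq> 0"
  proof
    assume "u *\<^sub>R x + v *\<^sub>R y = 0"
    then have eq: "u *\<^sub>R x = - (v *\<^sub>R y)"
      by (rule eq_neg_iff_add_eq_0[THEN iffD2])
    have "u *\<^sub>R x \<in> K" "v *\<^sub>R y \<in> K"
      using assms(2) xy uv by (auto simp: cone_def)
    then have "u *\<^sub>R x \<in> K \<inter> uminus ` K"
      using eq by auto
    then have "u *\<^sub>R x = 0" "v *\<^sub>R y = 0"
      using assms(3) eq by auto
    then show False
      using xy uv by auto
  qed
  ultimately show "u *\<^sub>R x + v *\<^sub>R y \<in> K - {0}"
    by blast
qed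

lemma separate_closed_cone_from_pointed_cone:
  fixes C K :: "'a::euclidean_space set"
  assumes C: "closed C" "convex C" "cone C" "0 \<in> C"
    and K: "closed K" "convex K" "cone K" "K \<inter> uminus ` K = {0}"
    and disj: "C \<inter> uminus ` K \<subseteq> {0}"
  obtains l where "\<And>v. v \<in> K - {0} \<Longrightarrow> 0 < l \<bullet> v" "\<And>w. w \<in> C \<Longrightarrow> 0 \<le> l \<bullet> w"
proof (cases "K = {0}")
  case True
  then show ?thesis
    using that[of 0] by simp
next
  case False
  define B where "B = uminus ` (convex hull (K \<inter> sphere 0 1))"
  have sub: "convex hull (K \<inter> sphere 0 1) \<subseteq> K - {0}"
    using convex_pointed_cone_minus_zero[OF K(2-4)] by (intro hull_minimal) auto
  have unit: "(1 / norm v) *\<^sub>R v \<in> K \<inter> sphere 0 1" if "v \<in> K - {0}" for v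
    using that K(3) by (auto simp: cone_def)
  have "K - {0} \<noteq> {}"
    using False K(4) by blast
  then have "B \<noteq> {}"
    unfolding B_def image_is_empty convex_hull_eq_empty using unit by blast
  moreover have "convex B" "compact B"
    unfolding B_def using K(1)
    by (auto intro!: convex_negations compact_negations compact_convex_hull closed_Int_compact)
  moreover have "C \<inter> B = {}"
    using disj sub by (fastforce simp: B_def)
  ultimately obtain a \<beta> where a: "\<And>w. w \<in> C \<Longrightarrow> a \<bullet> w < \<beta>" "\<And>w. w \<in> B \<Longrightarrow> \<beta> < a \<bullet> w"
    using separating_hyperplane_closed_compact[OF C(2,1)] by metis
  \<comment> \<open>Evaluating at \<open>0 \<in> C\<close> makes \<open>a\<close> positive on
    \<open>B\<close>. As \<open>B\<close> lies in \<open>- K\<close>, the functional wanted is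
    \<open>- a\<close>.\<close>
  have \<beta>: "0 < \<beta>"
    using a(1)[OF C(4)] by simp
  show ?thesis
  proof (rule that[of "- a"])
    fix v assume v: "v \<in> K - {0}"
    have "- ((1 / norm v) *\<^sub>R v) \<in> B"
      unfolding B_def using hull_inc[OF unit[OF v]] by blast
    then have "0 < a \<bullet> (- ((1 / norm v) *\<^sub>R v))"
      using a(2) \<beta> by fastforce
    then show "0 < - a \<bullet> v"
      using v by (auto simp: divide_simps)
  next
    fix w assume w: "w \<in> C"
    \<comment> \<open>Otherwise a positive multiple of \<open>w\<close>, still in \<open>C\<close>,
      would attain the value \<beta> exactly.\<close>
    have "a \<bullet> w \<le> 0"
    proof (rule ccontr)
      assume "\<not> a \<bullet> w \<le> 0"
      then have "(\<beta> / (a \<bullet> w)) *\<^sub>R w \<in> C"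
        using C(3) w \<beta> by (auto simp: cone_def)
      then show False
        using a(1) \<open>\<not> a \<bullet> w \<le> 0\<close> by fastforce
    qed
    then show "0 \<le> - a \<bullet> w"
      by simp
  qed
qed

text \<open>At a feasible \<open>x\<close> this is the tangent cone: only the coordinates where the
  sign constraint is active are restricted.\<close>

definition feasible_directions :: "real ^ 'n ^ 'm \<Rightarrow> real ^ 'n \<Rightarrow> (real ^ 'n) set" where
  "feasible_directions A x = {d. A *v d = 0 \<and> (\<forall>i. x $ i = 0 \<longrightarrow> 0 \<le> d $ i)}"

lemma cone_feasible_directions: "cone (feasible_directions A x)"
  by (auto simp: cone_def feasible_directions_def matrix_vector_mult_scaleR)

lemma polyhedron_feasible_directions: "polyhedron (feasible_directions A x)"
proof -
  have "feasible_directions A x =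
      {d. A *v d = 0} \<inter> \<Inter> ((\<lambda>i. {d. axis i 1 \<bullet> d \<ge> 0}) ` {i. x $ i = 0})"
    by (auto simp: feasible_directions_def inner_axis')
  moreover have "polyhedron {d. A *v d = 0}"
    by (intro affine_imp_polyhedron subspace_imp_affine linear_subspace_kernel) simp
  ultimately show ?thesis
    by (auto intro!: polyhedron_Int polyhedron_Inter polyhedron_halfspace_ge)
qed

text \<open>A coordinate that decreases along \<open>d\<close> is strictly positive at
  \<open>x\<close>, so it leaves room for a short step; finitely many coordinates admit a common
  one.\<close>

lemma feasible_directionsD:
  assumes "x \<in> feasible_set A b" "d \<in> feasible_directions A x"
  obtains t where "0 < t" "x + t *\<^sub>R d \<in> feasible_set A b"
proof -
  have "\<exists>t>0. \<forall>s. 0 < s \<and> s \<le> t \<longrightarrow> 0 \<le> x $ i + s * d $ i" for i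
  proof (cases "0 \<le> d $ i")
    case True
    then show ?thesis
      using assms(1) by (intro exI[of _ 1]) (auto simp: feasible_set_def nonneg_orthant_def)
  next
    case False
    then have "x $ i > 0"
      using assms by (auto simp: feasible_set_def nonneg_orthant_def feasible_directions_def less_le)
    with False show ?thesis
      \<comment> \<open>The step length at which coordinate \<open>i\<close> reaches 0.\<close>
      by (intro exI[of _ "x $ i / - d $ i"]) (auto simp: field_simps)
  qed
  then obtain t where t: "\<And>i. 0 < t i" "\<And>i s. 0 < s \<Longrightarrow> s \<le> t i \<Longrightarrow> 0 \<le> x $ i + s * d $ i"
    by metis
  have "0 < Min (range t)"
    using t(1) by simp
  moreover from this have "x + Min (range t) *\<^sub>R d \<in> feasible_set A b"
    using assms t(2) by (auto simp: feasible_set_def nonneg_orthant_def feasible_directions_def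
        matrix_vector_right_distrib matrix_vector_mult_scaleR)
  ultimately show ?thesis
    by (rule that)
qed

lemma diff_in_feasible_directions:
  assumes "x \<in> feasible_set A b" "y \<in> feasible_set A b"
  shows "y - x \<in> feasible_directions A x"
  using assms by (auto simp: feasible_set_def nonneg_orthant_def feasible_directions_def
      matrix_vector_mult_diff_distrib)

theorem theorem1:
  fixes K :: "(real ^ 'k) set"
    and L :: "real ^ 'n ^ 'k"
    and A :: "real ^ 'n ^ 'm"
    and b :: "real ^ 'm"
  assumes "nontrivial_cone K" and "pointed_cone K" and "closed K" and "convex K"
  shows "\<forall>xbar. efficient_solution K L A b xbar \<longrightarrow> properly_efficient_solution K L A b xbar"
proof (intro allI impI)
  fix xbar
  assume eff: "efficient_solution K L A b xbar"
  then have xbar: "xbar \<in> feasible_set A b"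
    by (simp add: efficient_solution_def)
  have K: "cone K" "K \<inter> uminus ` K = {0}"
    using assms(2) by (auto simp: pointed_cone_def)
  define T where "T = feasible_directions A xbar"
  have T: "polyhedron T" "cone T" "0 \<in> T"
    by (auto simp: T_def polyhedron_feasible_directions cone_feasible_directions)
      (simp add: feasible_directions_def)
  define C where "C = (*v) L ` T"
  have "closed C"
    unfolding C_def using T by (intro closed_linear_image_polyhedral_cone) auto
  moreover have "convex C"
    unfolding C_def using T by (intro convex_linear_image polyhedron_imp_convex) auto
  moreover have "cone C"
    using T(2) by (force simp: C_def cone_def simp flip: matrix_vector_mult_scaleR)
  moreover have "0 \<in> C"
    unfolding C_def using T(3) by (intro image_eqI[of _ _ 0]) auto
  moreover have "C \<inter> uminus ` K \<subseteq> {0}"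
  proof
    fix w assume "w \<in> C \<inter> uminus ` K"
    then obtain d where d: "d \<in> T" "w = L *v d" "- w \<in> K"
      by (auto simp: C_def)
    obtain t where t: "0 < t" "xbar + t *\<^sub>R d \<in> feasible_set A b"
      using feasible_directionsD[OF xbar] d(1) unfolding T_def by blast
    have L: "L *v (xbar + t *\<^sub>R d) = L *v xbar + t *\<^sub>R w"
      by (simp add: d(2) matrix_vector_right_distrib matrix_vector_mult_scaleR)
    \<comment> \<open>This vector is the decrease of the objective from \<open>xbar\<close> to
      \<open>xbar + t *\<^sub>R d\<close>. Efficiency then forces it to be 0.\<close>
    have "t *\<^sub>R (- w) \<in> K"
      using K(1) d(3) t(1) unfolding cone_def by (meson less_imp_le)
    then have "cone_leqq K (L *v (xbar + t *\<^sub>R d)) (L *v xbar)"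
      by (simp add: cone_leqq_def L)
    with eff t have "L *v (xbar + t *\<^sub>R d) = L *v xbar"
      by (auto simp: efficient_solution_def cone_leq_def)
    with L t(1) show "w \<in> {0}"
      by simp
  qed
  ultimately obtain l where l: "\<And>v. v \<in> K - {0} \<Longrightarrow> 0 < l \<bullet> v" "\<And>w. w \<in> C \<Longrightarrow> 0 \<le> l \<bullet> w"
    using separate_closed_cone_from_pointed_cone[OF _ _ _ _ assms(3,4) K] by metis
  have "l \<bullet> (L *v xbar) \<le> l \<bullet> (L *v x)" if "x \<in> feasible_set A b" for x
  proof -
    \<comment> \<open>Nonnegativity of \<open>l\<close> on \<open>C\<close>, applied to the
      direction from \<open>xbar\<close> to \<open>x\<close>, is the scalarized inequality.\<close>
    have "L *v (x - xbar) \<in> C"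
      unfolding C_def T_def using diff_in_feasible_directions[OF xbar that] by blast
    then show ?thesis
      using l(2) by (fastforce simp: matrix_vector_mult_diff_distrib inner_diff_right)
  qed
  with l(1) xbar show "properly_efficient_solution K L A b xbar"
    by (auto simp: properly_efficient_solution_def quasi_interior_dual_def)
qed

end
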